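(* Let $X,X'$ be two compact metric spaces. If the Hausdorff dimension of $X$ is strictly larger than the upper Minkowski dimension of $X'$, then for any $p,p'\in[1,\infty)$ there is no bi-Lipschitz embedding $\mathscr{W}_p(X)\to\mathscr{W}_{p'}(X')$.
   Context: For a compact metric space $X$ and $p\in[1,+\infty)$, $\mathscr{W}_p(X)=(\mathcal{P}(X),\mathrm{W}_p)$ is the set of Borel probability measures on $X$ endowed with the distance $$\mathrm{W}_p(\mu,\nu)=\left(\inf_{\Pi\in\Gamma(\mu,\nu)}\int_{X\times X}d(a,b)^p\,\Pi(\mathrm{d}a\,\mathrm{d}b)\right)^{1/p},$$ where $\Gamma(\mu,\nu)$ is the set of Borel probability measures on $X\times X$ with marginals $\mu$ and $\nu$. The upper Minkowski dimension of a compact metric space is $\limsup_{\varepsilon\to0}\frac{\log N(\varepsilon)}{\log(1/\varepsilon)}$, where $N(\varepsilon)$ is the least number of balls of radius $\varepsilon$ needed to cover it. A bi-Lipschitz embedding is a map $f$ between metric spaces for which there are constants $c,C>0$ with $c\,d(a,b)\le d(f(a),f(b))\le C\,d(a,b)$ for all $a,b$. *)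

theory Defs
  imports "HOL-Probability.Probability"
begin

text \<open>A compact metric space is a type of class \<^class>\<open>metric_space\<close> whose universe is compact.\<close>

definition borel_prob_measures :: "'a::metric_space measure set" where
  "borel_prob_measures = {M. prob_space M \<and> sets M = sets borel}"

text \<open>
  The \<open>\<sigma>\<close>-algebra on the square is the Borel one of the product topology. It is not
  written \<open>borel \<Otimes>\<^sub>M borel\<close>, which the library identifies with it only for types of class
  \<^class>\<open>second_countable_topology\<close>.
\<close>
definition couplings :: "'a::metric_space measure \<Rightarrow> 'a measure \<Rightarrow> ('a \<times> 'a) measure set" where
  "couplings \<mu> \<nu> =
     {\<gamma> \<in> borel_prob_measures. distr \<gamma> borel fst = \<mu> \<and> distr \<gamma> borel snd = \<nu>}"

text \<open>
  On a compact space the infimum is finite, so the conversion with \<^const>\<open>enn2real\<close> is harmless.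
\<close>
definition wasserstein_dist :: "real \<Rightarrow> 'a::metric_space measure \<Rightarrow> 'a measure \<Rightarrow> real" where
  "wasserstein_dist p \<mu> \<nu> =
     enn2real (INF \<gamma> \<in> couplings \<mu> \<nu>. \<integral>\<^sup>+ (a, b). ennreal (dist a b powr p) \<partial>\<gamma>) powr (1 / p)"

definition bi_lipschitz_embedding ::
    "'a set \<Rightarrow> ('a \<Rightarrow> 'a \<Rightarrow> real) \<Rightarrow> 'b set \<Rightarrow> ('b \<Rightarrow> 'b \<Rightarrow> real) \<Rightarrow> ('a \<Rightarrow> 'b) \<Rightarrow> bool" where
  "bi_lipschitz_embedding A dA B dB f \<longleftrightarrow>
     f ` A \<subseteq> B \<and>
     (\<exists>c>0. \<exists>C>0. \<forall>a\<in>A. \<forall>b\<in>A. c * dA a b \<le> dB (f a) (f b) \<and> dB (f a) (f b) \<le> C * dA a b)"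

text \<open>
  Boundedness is required explicitly because \<^const>\<open>diameter\<close> is a real number, without meaning
  for unbounded sets. Since \<open>0 powr 0 = 0\<close>, the premeasure is the usual one only for \<open>s > 0\<close>,
  and only such exponents enter the dimension. Finite covers are included by taking
  \<open>U i = {}\<close> from some index on.
\<close>
definition hausdorff_premeasure :: "real \<Rightarrow> real \<Rightarrow> 'a::metric_space set \<Rightarrow> ennreal" where
  "hausdorff_premeasure s \<delta> S =
     (INF U \<in> {U :: nat \<Rightarrow> 'a set. S \<subseteq> (\<Union>i. U i) \<and> (\<forall>i. bounded (U i) \<and> diameter (U i) \<le> \<delta>)}.
        \<Sum>i. ennreal (diameter (U i) powr s))"

definition hausdorff_measure :: "real \<Rightarrow> 'a::metric_space set \<Rightarrow> ennreal" where
  "hausdorff_measure s S = (SUP \<delta>\<in>{0<..}. hausdorff_premeasure s \<delta> S)"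

definition hausdorff_dimension :: "'a::metric_space set \<Rightarrow> ereal" where
  "hausdorff_dimension S = Inf {ereal s | s. s > 0 \<and> hausdorff_measure s S = 0}"

definition covering_number :: "'a::metric_space set \<Rightarrow> real \<Rightarrow> nat" where
  "covering_number S \<epsilon> =
     (LEAST n. \<exists>C. finite C \<and> card C = n \<and> C \<subseteq> S \<and> S \<subseteq> (\<Union>x\<in>C. ball x \<epsilon>))"

definition upper_minkowski_dimension :: "'a::metric_space set \<Rightarrow> ereal" where
  "upper_minkowski_dimension S =
     Limsup (at_right 0) (\<lambda>\<epsilon>. ereal (ln (real (covering_number S \<epsilon>)) / ln (1 / \<epsilon>)))"

end

theory Submission
  imports Defs "HOL-Real_Asymp.Real_Asymp"
begin

text \<open>
  Compare metric entropies of the two Wasserstein spaces. Let \<open>t < s\<close> lie strictly between the two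
  dimensions. For small \<open>\<epsilon>\<close> the space \<open>X\<close> contains an \<open>\<epsilon>\<close>-separated set of at least
  \<open>\<epsilon> powr -s\<close> points, since otherwise covers by few balls would make some Hausdorff measure of
  exponent below the dimension vanish. Transporting mass between the points of such a set costs at
  least \<open>\<epsilon>\<close> per unit, so a code of subsets with large Hamming distance (Gilbert--Varshamov) yields
  \<open>exp (const * \<epsilon> powr -s)\<close> probability measures on \<open>X\<close> at mutual distance at least
  \<open>const * \<epsilon>\<close>. On the other side, partition \<open>X'\<close> into at most \<open>\<epsilon> powr -t\<close> cells of
  diameter at most \<open>2 * \<epsilon>\<close>: two measures that give nearly the same mass to every cell are at
  distance at most \<open>const * \<epsilon>\<close>, and rounding the masses leaves only
  \<open>exp (const * \<epsilon> powr -t * ln (1 / \<epsilon>))\<close> classes. An embedding expanding distances at least by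
  a constant factor is therefore impossible.
\<close>

section \<open>Borel sets of the square of a compact space\<close>

text \<open>Compactness supplies finite nets at every scale, hence a countable topological basis.
  Products of its members are measurable rectangles and form a countable basis of the square, so
  they generate its whole Borel \<sigma>-algebra. This allows couplings to be built as densities
  with respect to a product measure.\<close>

lemma compact_imp_borel_prod:
  assumes "compact (UNIV :: 'a::metric_space set)"
  shows "sets (borel \<Otimes>\<^sub>M borel :: ('a \<times> 'a) measure) = sets borel"
proof
  show "sets (borel \<Otimes>\<^sub>M borel :: ('a \<times> 'a) measure) \<subseteq> sets borel"
    by (rule sets_pair_in_sets) (auto intro: borel_Times)
next
  have "\<exists>k. finite k \<and> (\<Union>x\<in>k. ball x (1 / real (Suc n))) = (UNIV :: 'a set)" for n
    using seq_compact_imp_totally_bounded[of "UNIV :: 'a set"] assms compact_imp_seq_compact by (metis divide_pos_pos of_nat_0_less_iff zero_less_Suc zero_less_one top.extremum_unique)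
  then obtain k where k: "\<And>n. finite (k n)" "\<And>n. (\<Union>x\<in>k n. ball x (1 / real (Suc n))) = (UNIV :: 'a set)"
    by metis
  define B where "B = (\<Union>n. (\<lambda>x. ball x (1 / real (Suc n))) ` k n)"
  have cB: "countable B"
    unfolding B_def using k(1) by (intro countable_UN) (auto intro: countable_finite)
  have "topological_basis B"
  proof (rule topological_basisI)
    fix S x assume "open S" "x \<in> (S :: 'a set)"
    then obtain e where e: "e > 0" "ball x e \<subseteq> S" by (meson openE)
    obtain n where n: "1 / real (Suc n) < e / 2"
      using nat_approx_posE[of "e/2"] e by (metis half_gt_zero)
    obtain y where y: "y \<in> k n" "dist y x < 1 / real (Suc n)" using k(2)[of n] by (auto simp: set_eq_iff)
    have "ball y (1 / real (Suc n)) \<subseteq> ball x e"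
    proof
      fix z assume "z \<in> ball y (1 / real (Suc n))"
      then show "z \<in> ball x e" using n y(2) dist_triangle3[of x z y] by auto
    qed
    then show "\<exists>B'\<in>B. x \<in> B' \<and> B' \<subseteq> S"
      using y e by (intro bexI[of _ "ball y (1 / real (Suc n))"]) (auto simp: B_def)
  qed (auto simp: B_def)
  then have tb: "topological_basis ((\<lambda>(a, b). a \<times> b) ` (B \<times> B))" by (intro topological_basis_prod)
  have cP: "countable ((\<lambda>(a, b). a \<times> b) ` (B \<times> B))" using cB by auto
  have "sets (borel :: ('a \<times> 'a) measure) = sigma_sets UNIV ((\<lambda>(a, b). a \<times> b) ` (B \<times> B))"
    by (subst borel_eq_countable_basis[OF cP tb]) simp
  also have "\<dots> \<subseteq> sets (borel \<Otimes>\<^sub>M borel :: ('a \<times> 'a) measure)"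
    using sets.sigma_sets_subset[of "(\<lambda>(a, b). a \<times> b) ` (B \<times> B)" "borel \<Otimes>\<^sub>M borel :: ('a \<times> 'a) measure"]
    by (auto simp: B_def space_pair_measure image_subset_iff)
  finally show "sets (borel :: ('a \<times> 'a) measure) \<subseteq> sets (borel \<Otimes>\<^sub>M borel :: ('a \<times> 'a) measure)" .
qed

section \<open>Separated sets from the Hausdorff dimension\<close>

text \<open>A ball of radius \<open>e\<close> has diameter at most \<open>2 * e\<close>, so covers
  by balls of one common radius already bound the premeasure. As \<open>h\<close> is arbitrarily
  small at every scale \<open>d\<close>, each premeasure vanishes.\<close>

lemma hausdorff_measure_eq_0_if_covers:
  assumes "0 < s"
    and "\<And>d h. d > 0 \<Longrightarrow> h > 0 \<Longrightarrow> \<exists>C e. finite C \<and> 0 < e \<and> 2 * e \<le> d \<and> S \<subseteq> (\<Union>x\<in>C. ball x e)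
          \<and> real (card C) * (2 * e) powr s \<le> h"
  shows "hausdorff_measure s S = 0"
proof -
  have "hausdorff_premeasure s d S \<le> ennreal h" if dh: "d > 0" "h > 0" for d h
  proof -
    obtain C e where C: "finite C" "0 < e" "2 * e \<le> d" "S \<subseteq> (\<Union>x\<in>C. ball x e)"
      "real (card C) * (2 * e) powr s \<le> h" using assms(2)[OF dh] by (elim exE conjE) (rule that)
    obtain g where g: "bij_betw g {..<card C} C"
      using ex_bij_betw_nat_finite[OF C(1)] by (auto simp: atLeast0LessThan)
    \<comment> \<open>The premeasure ranges over sequences of sets; padding with \<open>{}\<close>
      costs nothing because \<open>{}\<close> has diameter \<open>0\<close> and
      \<open>0 powr s = 0\<close>.\<close>
    define U where "U i = (if i < card C then ball (g i) e else {})" for i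
    have dia: "diameter (ball x e) \<le> 2 * e" for x :: 'a
    proof -
      have "dist y z \<le> 2 * e" if "y \<in> ball x e" "z \<in> ball x e" for y z
        using that dist_triangle3[of y z x] by simp
      then show ?thesis unfolding diameter_def using C(2) by (auto intro!: cSUP_least)
    qed
    have cov: "S \<subseteq> (\<Union>i. U i)"
    proof
      fix y assume "y \<in> S"
      then obtain x where "x \<in> C" "y \<in> ball x e" using C(4) by (meson UN_E subsetD)
      moreover obtain i where "i < card C" "g i = x"
        using bij_betw_imp_surj_on[OF g] \<open>x \<in> C\<close> by (metis imageE lessThan_iff)
      ultimately show "y \<in> (\<Union>i. U i)" by (auto simp: U_def intro!: exI[of _ i])
    qed
    have dU: "bounded (U i) \<and> diameter (U i) \<le> d" for i
      using C(2,3) dia[of "g i"] by (auto simp: U_def diameter_def)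
    have "hausdorff_premeasure s d S \<le> (\<Sum>i. ennreal (diameter (U i) powr s))"
      unfolding hausdorff_premeasure_def using cov dU by (intro INF_lower) auto
    also have "\<dots> = (\<Sum>i<card C. ennreal (diameter (U i) powr s))"
      by (intro suminf_finite) (auto simp: U_def diameter_def)
    also have "\<dots> \<le> (\<Sum>i<card C. ennreal ((2 * e) powr s))"
      using dia assms(1) by (intro sum_mono ennreal_leI powr_mono2) (auto simp: U_def diameter_ge_0)
    also have "\<dots> = ennreal (real (card C) * (2 * e) powr s)"
      by (simp add: ennreal_mult ennreal_of_nat_eq_real_of_nat)
    also have "\<dots> \<le> ennreal h" using C(5) by (rule ennreal_leI)
    finally show ?thesis .
  qed
  note le = this
  have "hausdorff_premeasure s d S = 0" if "d > 0" for d
  proof -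
    have "hausdorff_premeasure s d S \<le> 0"
    proof (rule ennreal_le_epsilon)
      fix h :: real assume "0 < h"
      then show "hausdorff_premeasure s d S \<le> 0 + ennreal h" unfolding add_0 by (rule le[OF that])
    qed
    then show ?thesis by simp
  qed
  then have "(SUP d\<in>{0<..}. hausdorff_premeasure s d S) = (SUP d\<in>{0::real<..}. 0)"
    by (intro SUP_cong) auto
  then show ?thesis unfolding hausdorff_measure_def by simp
qed

text \<open>An \<open>e\<close>-separated set of maximal cardinality is also an
  \<open>e\<close>-net. If separated sets stayed too small at arbitrarily small scales, these nets
  would make the Hausdorff measure vanish for some exponent \<open>s'\<close> between
  \<open>s\<close> and the dimension.\<close>

lemma ex_large_separated_set:
  assumes s: "0 < s" "ereal s < hausdorff_dimension (S :: 'a::metric_space set)"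
  shows "eventually (\<lambda>e. \<exists>A\<subseteq>S. finite A \<and> (\<forall>x\<in>A. \<forall>y\<in>A. x \<noteq> y \<longrightarrow> e \<le> dist x y) \<and> (1 / e) powr s \<le> real (card A))
           (at_right 0)"
proof (rule ccontr)
  let ?P = "\<lambda>e A. A \<subseteq> S \<and> finite A \<and> (\<forall>x\<in>A. \<forall>y\<in>A. x \<noteq> y \<longrightarrow> e \<le> dist x y)"
  assume neg: "\<not> ?thesis"
  \<comment> \<open>The strict gap \<open>s < s'\<close> is what makes
    \<open>(1 / e) powr s * (2 * e) powr s'\<close> tend to \<open>0\<close>.\<close>
  obtain s' where s': "s < s'" "ereal s' < hausdorff_dimension S"
    using ereal_dense2[OF s(2)] by auto
  have "hausdorff_measure s' S = 0"
  proof (rule hausdorff_measure_eq_0_if_covers)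
    show "0 < s'" using s s' by simp
    fix d h :: real assume dh: "d > 0" "h > 0"
    have "((\<lambda>e. (1 / e) powr s * (2 * e) powr s') \<longlongrightarrow> 0) (at_right 0)"
      using s s' by real_asymp
    then have "eventually (\<lambda>e. (1 / e) powr s * (2 * e) powr s' < h) (at_right 0)"
      using dh(2) by (rule order_tendstoD)
    moreover have "eventually (\<lambda>e. e < d / 2 \<and> e > 0) (at_right 0)"
      using dh(1) by (intro eventually_at_rightI[of 0 "d/2"]) auto
    ultimately have ev: "eventually (\<lambda>e. (1 / e) powr s * (2 * e) powr s' < h \<and> e < d / 2 \<and> e > 0) (at_right 0)"
      by (rule eventually_conj)
    \<comment> \<open>The negation provides only arbitrarily small bad scales, not all small ones.
      That suffices: for given \<open>d\<close> and \<open>h\<close> a single scale yields the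
      cover.\<close>
    have fr: "frequently (\<lambda>e. \<not> (\<exists>A. ?P e A \<and> (1 / e) powr s \<le> real (card A))) (at_right 0)"
      using neg unfolding frequently_def not_not conj_assoc Bex_def .
    obtain e where e0: "\<not> (\<exists>A. ?P e A \<and> (1 / e) powr s \<le> real (card A))"
      "(1 / e) powr s * (2 * e) powr s' < h" "e < d / 2" "e > 0"
      using frequently_ex[OF frequently_eventually_conj[OF fr ev]] by (elim exE conjE) (rule that)
    have e: "\<And>A. ?P e A \<Longrightarrow> real (card A) < (1 / e) powr s"
      "(1 / e) powr s * (2 * e) powr s' < h" "e < d / 2" "e > 0"
      using e0 not_le by blast+
    \<comment> \<open>The cardinality bound at a bad scale guarantees that a largest separated set
      exists.\<close>
    have "\<exists>A. ?P e A \<and> (\<forall>A'. ?P e A' \<longrightarrow> card A' \<le> card A)"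
    proof (rule ex_has_greatest_nat[of "?P e" "{}" card "nat \<lceil>(1 / e) powr s\<rceil>"])
      show "\<forall>y. ?P e y \<longrightarrow> card y < nat \<lceil>(1 / e) powr s\<rceil>"
      proof (intro allI impI)
        fix y assume "?P e y"
        then have "real (card y) < (1 / e) powr s" by (rule e(1))
        then show "card y < nat \<lceil>(1 / e) powr s\<rceil>" by linarith
      qed
    qed auto
    then obtain A where A: "?P e A" "\<And>A'. ?P e A' \<Longrightarrow> card A' \<le> card A" by (elim exE conjE) (rule that, auto)
    have "S \<subseteq> (\<Union>x\<in>A. ball x e)"
    proof
      fix y assume y: "y \<in> S"
      show "y \<in> (\<Union>x\<in>A. ball x e)"
      proof (rule ccontr)
        assume n: "\<not> ?thesis"
        have "?P e (insert y A)" using A(1) n y by (auto simp: dist_commute not_less)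
        moreover have "y \<notin> A" using n e(4) by auto
        ultimately show False using A(2)[of "insert y A"] A(1) by simp
      qed
    qed
    moreover have "real (card A) * (2 * e) powr s' \<le> h"
      using e(1)[OF A(1)] e(2) by (smt (verit) mult_right_mono powr_ge_zero)
    ultimately show "\<exists>C e. finite C \<and> 0 < e \<and> 2 * e \<le> d \<and> S \<subseteq> (\<Union>x\<in>C. ball x e)
          \<and> real (card C) * (2 * e) powr s' \<le> h"
      using A(1) e by (intro exI[of _ A] exI[of _ e]) auto
  qed
  then have "hausdorff_dimension S \<le> ereal s'"
    unfolding hausdorff_dimension_def using s s' by (intro Inf_lower) auto
  then show False using s'(2) by simp
qed

section \<open>Covers from the upper Minkowski dimension\<close>

text \<open>For \<open>e < 1\<close> the number \<open>ln (1 / e)\<close> is positive, so the bound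
  \<open>t\<close> for the quotient can be cleared of its denominator and exponentiated.\<close>

lemma card_cover_less_of_minkowski:
  assumes "compact S" "S \<noteq> {}" "upper_minkowski_dimension S < ereal t"
  shows "eventually (\<lambda>e. \<exists>C. finite C \<and> S \<subseteq> (\<Union>x\<in>C. ball x e) \<and> real (card C) \<le> (1 / e) powr t) (at_right 0)"
proof -
  have "eventually (\<lambda>e. ereal (ln (real (covering_number S e)) / ln (1 / e)) < ereal t) (at_right 0)"
    using assms(3) unfolding upper_minkowski_dimension_def by (rule Limsup_lessD)
  moreover have "eventually (\<lambda>e. e < 1 \<and> e > 0) (at_right (0::real))"
    by (rule eventually_at_rightI[of 0 1]) auto
  ultimately show ?thesis
  proof eventually_elim
    case (elim e)
    then have e: "0 < e" "e < 1" by auto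
    let ?Q = "\<lambda>n C. finite C \<and> card C = n \<and> C \<subseteq> S \<and> S \<subseteq> (\<Union>x\<in>C. ball x e)"
    \<comment> \<open>Total boundedness shows that some finite cover exists; only then is the
      \<open>LEAST\<close> in \<open>covering_number\<close> attained.\<close>
    obtain C0 where "?Q (card C0) C0"
      using seq_compact_imp_totally_bounded[OF compact_imp_seq_compact[OF assms(1)], rule_format, OF e(1)]
      by (elim exE conjE) (rule that, intro conjI refl)
    then have "\<exists>C. ?Q (card C0) C" by (rule exI)
    from LeastI[of "\<lambda>n. \<exists>C. ?Q n C", OF this] 
    obtain C where C: "finite C" "card C = covering_number S e" "S \<subseteq> (\<Union>x\<in>C. ball x e)"
      unfolding covering_number_def[symmetric] by (elim exE conjE) (rule that)
    have "C \<noteq> {}" using C(3) assms(2) by auto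
    then have pos: "card C > 0" using C(1) by (simp add: card_gt_0_iff)
    have "ln (real (card C)) < t * ln (1 / e)"
      using elim C(2) e by (simp add: divide_simps ln_div split: if_splits)
    then have "real (card C) \<le> (1 / e) powr t"
      using pos e by (smt (verit) exp_le_cancel_iff exp_ln of_nat_0_less_iff powr_def zero_less_divide_1_iff)
    then show ?case using C by blast
  qed
qed

text \<open>A negative exponent \<open>t\<close> would force the number of covering balls below
  \<open>1\<close> at small scales, and no nonempty set has an empty cover.\<close>

lemma upper_minkowski_dimension_nonneg:
  assumes "compact S" "S \<noteq> {}"
  shows "0 \<le> upper_minkowski_dimension S"
proof (rule ccontr)
  assume "\<not> ?thesis"
  then obtain t where t: "upper_minkowski_dimension S < ereal t" "t < 0"
    using ereal_dense2[of "upper_minkowski_dimension S" 0] by (metis ereal_less(1) not_le zero_ereal_def ereal_less_eq(3))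
  have "((\<lambda>e::real. (1 / e) powr t) \<longlongrightarrow> 0) (at_right 0)" using t(2) by real_asymp
  then have "eventually (\<lambda>e. (1 / e) powr t < 1) (at_right 0)" by (rule order_tendstoD) simp
  with card_cover_less_of_minkowski[OF assms t(1)]
  have "eventually (\<lambda>e::real. False) (at_right 0)"
  proof eventually_elim
    case (elim e)
    from elim(1) obtain C where C: "finite C" "S \<subseteq> (\<Union>x\<in>C. ball x e)" "real (card C) \<le> (1 / e) powr t"
      by (elim exE conjE) (rule that)
    then have "card C = 0" using elim(2) by linarith
    then show ?case using C assms(2) by simp
  qed
  then show False by simp
qed

section \<open>Binary codes with large Hamming distance\<close>

text \<open>
  Exponential Chebyshev bound with the weight \<open>81/256 = (3/4)^4\<close>, which turns the radius
  \<open>card T / 4\<close> into the factor \<open>(4/3)^card T\<close>.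
\<close>
lemma card_hamming_ball_le:
  assumes "finite T" "A \<subseteq> T"
  shows "real (card {B \<in> Pow T. 4 * card (sym_diff A B) < card T}) \<le> (16/9) ^ card T"
proof -
  let ?w = "\<lambda>D :: 'a set. (81/256 :: real) ^ card D"
  have fin: "finite (Pow T)" using assms by simp
  have one: "1 \<le> (4/3) ^ card T * ?w (sym_diff A B)"
    if "4 * card (sym_diff A B) < card T" for B
  proof -
    have "(3/4 :: real) ^ card T \<le> (3/4) ^ (4 * card (sym_diff A B))"
      using that by (intro power_decreasing) auto
    also have "\<dots> = ?w (sym_diff A B)" by (simp add: power_mult power_divide)
    finally have "(4/3 :: real) ^ card T * (3/4) ^ card T \<le> (4/3) ^ card T * ?w (sym_diff A B)"
      by (intro mult_left_mono) auto
    then show ?thesis by (simp add: power_mult_distrib[symmetric])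
  qed
  have "real (card {B \<in> Pow T. 4 * card (sym_diff A B) < card T})
      = (\<Sum>B\<in>{B \<in> Pow T. 4 * card (sym_diff A B) < card T}. 1)" by simp
  also have "\<dots> \<le> (\<Sum>B\<in>{B \<in> Pow T. 4 * card (sym_diff A B) < card T}. (4/3) ^ card T * ?w (sym_diff A B))"
    using one by (intro sum_mono) auto
  also have "\<dots> \<le> (\<Sum>B\<in>Pow T. (4/3) ^ card T * ?w (sym_diff A B))"
    using fin by (intro sum_mono2) auto
  \<comment> \<open>\<open>sym_diff A\<close> is an involution of \<open>Pow T\<close>, so the
    weighted sum does not depend on the centre \<open>A\<close>.\<close>
  also have "\<dots> = (\<Sum>D\<in>Pow T. (4/3) ^ card T * ?w D)"
    by (rule sum.reindex_bij_witness[of _ "sym_diff A" "sym_diff A"]) (use assms(2) in auto)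
  \<comment> \<open>Expanding the product over subsets gives one factor \<open>337/256\<close> per
    element; multiplied by \<open>4/3\<close> it is \<open>337/192\<close>, just below
    \<open>16/9\<close>.\<close>
  also have "\<dots> = (4/3) ^ card T * (\<Prod>x\<in>T. 81/256 + 1)"
    by (subst prod_add[OF assms(1)]) (simp add: sum_distrib_left)
  also have "\<dots> = (337/192) ^ card T" by (simp add: power_mult_distrib[symmetric])
  also have "\<dots> \<le> (16/9) ^ card T" by (intro power_mono) auto
  finally show ?thesis .
qed

text \<open>Gilbert--Varshamov argument: around a code of maximal size the Hamming balls of radius
  \<open>card T / 4\<close> cover \<open>Pow T\<close>, since an uncovered set could be added.
  Dividing \<open>2 ^ card T\<close> by the bound \<open>(16/9) ^ card T\<close> for one ball leaves
  \<open>(9/8) ^ card T\<close>.\<close>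

lemma ex_large_code:
  assumes "finite T"
  shows "\<exists>F\<subseteq>Pow T. (\<forall>A\<in>F. \<forall>B\<in>F. A \<noteq> B \<longrightarrow> card T \<le> 4 * card (sym_diff A B)) \<and> (9/8) ^ card T \<le> real (card F)"
proof -
  let ?P = "\<lambda>F. F \<subseteq> Pow T \<and> (\<forall>A\<in>F. \<forall>B\<in>F. A \<noteq> B \<longrightarrow> card T \<le> 4 * card (sym_diff A B))"
  have "\<exists>F. ?P F \<and> (\<forall>F'. ?P F' \<longrightarrow> card F' \<le> card F)"
  proof (rule ex_has_greatest_nat[of ?P "{}" card "Suc (card (Pow T))"])
    show "\<forall>F. ?P F \<longrightarrow> card F < Suc (card (Pow T))"
      using card_mono[of "Pow T"] assms by (simp add: less_Suc_eq_le)
  qed auto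
  then obtain F where F: "?P F" "\<And>F'. ?P F' \<Longrightarrow> card F' \<le> card F"
    by (elim exE conjE) (rule that, auto)
  have finF: "finite F" using F(1) assms by (meson finite_Pow_iff finite_subset)
  let ?V = "\<lambda>A. {B \<in> Pow T. 4 * card (sym_diff A B) < card T}"
  have "Pow T \<subseteq> (\<Union>A\<in>F. ?V A) \<union> F"
  proof (rule subsetI, rule ccontr)
    fix B assume B: "B \<in> Pow T" "B \<notin> (\<Union>A\<in>F. ?V A) \<union> F"
    have "card T \<le> 4 * card (sym_diff A B)" if "A \<in> F" for A using B that by (auto simp: not_less)
    then have "?P (insert B F)" using F(1) B by (auto simp: Un_commute)
    then have "card (insert B F) \<le> card F" by (rule F(2))
    then show False using B finF by simp
  qed
  \<comment> \<open>The balls are given by a strict inequality, so a code word lies in its own ball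
    only if \<open>card T\<close> is positive. Hence the separate empty case; otherwise the summand
    \<open>F\<close> in the cover is absorbed.\<close>
  show ?thesis
  proof (cases "T = {}")
    case True
    then show ?thesis by (intro exI[of _ "{{}}"]) auto
  next
    case False
    then have "A \<in> ?V A" if "A \<in> F" for A using that F(1) assms by (auto simp: card_gt_0_iff)
    with \<open>Pow T \<subseteq> (\<Union>A\<in>F. ?V A) \<union> F\<close> have "Pow T \<subseteq> (\<Union>A\<in>F. ?V A)" by blast
    then have "card (Pow T) \<le> card (\<Union>A\<in>F. ?V A)"
      using assms finF by (intro card_mono) auto
    also have "\<dots> \<le> (\<Sum>A\<in>F. card (?V A))" using finF by (rule card_UN_le)
    finally have "real (card (Pow T)) \<le> (\<Sum>A\<in>F. real (card (?V A)))"
      unfolding of_nat_sum[symmetric] by (rule of_nat_mono)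
    also have "\<dots> \<le> (\<Sum>A\<in>F. (16/9) ^ card T)"
      using F(1) assms by (intro sum_mono card_hamming_ball_le) auto
    finally have "2 ^ card T \<le> real (card F) * (16/9) ^ card T"
      using assms by (simp add: card_Pow)
    moreover have "(2::real) ^ card T = (9/8) ^ card T * (16/9) ^ card T"
      by (simp add: power_mult_distrib[symmetric])
    ultimately have "(9/8) ^ card T \<le> real (card F)"
      using mult_le_cancel_right_pos[of "(16/9) ^ card T" "(9/8) ^ card T" "real (card F)"] by simp
    with F(1) show ?thesis by (intro exI[of _ F] conjI) auto
  qed
qed

section \<open>Lower bounds for the Wasserstein distance\<close>

text \<open>One coordinate can lie in \<open>P\<close> and the other outside only off the diagonal,
  so the off-diagonal event \<open>E\<close> has mass at least the difference of the masses of
  \<open>P\<close>. Both marginals are concentrated on \<open>S\<close>, so almost every pair in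
  \<open>E\<close> pays at least \<open>e powr p\<close>.\<close>

lemma coupling_cost_ge:
  fixes \<mu> \<nu> :: "'a::metric_space measure"
  assumes \<gamma>: "\<gamma> \<in> couplings \<mu> \<nu>" and p: "0 < p" and e: "0 < e"
    and S: "S \<in> sets borel" "emeasure \<mu> S = 1" "emeasure \<nu> S = 1"
    and sep: "\<And>x y. x \<in> S \<Longrightarrow> y \<in> S \<Longrightarrow> x \<noteq> y \<Longrightarrow> e \<le> dist x y"
    and P: "P \<in> sets borel"
  shows "ennreal (e powr p * \<bar>measure \<mu> P - measure \<nu> P\<bar>) \<le> (\<integral>\<^sup>+ (a, b). ennreal (dist a b powr p) \<partial>\<gamma>)"
proof -
  have sets: "sets \<gamma> = sets borel" and marg: "distr \<gamma> borel fst = \<mu>" "distr \<gamma> borel snd = \<nu>"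
    using \<gamma> by (auto simp: couplings_def borel_prob_measures_def)
  interpret prob_space \<gamma> using \<gamma> by (auto simp: couplings_def borel_prob_measures_def)
  have sp: "space \<gamma> = UNIV" using sets_eq_imp_space_eq[OF sets] by simp
  have mfst: "fst \<in> measurable \<gamma> borel" and msnd: "snd \<in> measurable \<gamma> borel"
    unfolding measurable_cong_sets[OF sets refl]
    by (intro borel_measurable_continuous_onI continuous_intros)+
  have efst: "emeasure \<mu> Q = emeasure \<gamma> (fst -` Q)" if "Q \<in> sets borel" for Q
    unfolding marg(1)[symmetric] using that mfst by (simp add: emeasure_distr sp)
  have esnd: "emeasure \<nu> Q = emeasure \<gamma> (snd -` Q)" if "Q \<in> sets borel" for Q
    unfolding marg(2)[symmetric] using that msnd by (simp add: emeasure_distr sp)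
  have vfst: "fst -` Q \<in> events" if "Q \<in> sets borel" for Q using measurable_sets[OF mfst that] sp by simp
  have vsnd: "snd -` Q \<in> events" if "Q \<in> sets borel" for Q using measurable_sets[OF msnd that] sp by simp
  define E where "E = {z. fst z \<noteq> (snd z :: 'a)}"
  have E: "E \<in> events" unfolding E_def sets
    by (intro borel_open open_Collect_neq continuous_intros)
  have m: "measure \<mu> P = prob (fst -` P)" "measure \<nu> P = prob (snd -` P)"
    using efst[OF P] esnd[OF P] by (simp_all add: measure_def)
  have "prob (fst -` P) \<le> prob (snd -` P \<union> E)" "prob (snd -` P) \<le> prob (fst -` P \<union> E)"
    using E vfst[OF P] vsnd[OF P] by (auto intro!: finite_measure_mono simp: E_def)
  moreover have "prob (snd -` P \<union> E) \<le> prob (snd -` P) + prob E" "prob (fst -` P \<union> E) \<le> prob (fst -` P) + prob E"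
    using E vfst[OF P] vsnd[OF P] by (auto intro!: measure_Un_le)
  ultimately have pE: "\<bar>measure \<mu> P - measure \<nu> P\<bar> \<le> prob E" unfolding m by linarith
  have "AE z in \<gamma>. z \<in> fst -` S" "AE z in \<gamma>. z \<in> snd -` S"
    using efst[OF S(1)] esnd[OF S(1)] S vfst[OF S(1)] vsnd[OF S(1)]
    by (intro AE_prob_1; simp add: measure_def)+
  then have ae: "AE z in \<gamma>. ennreal (e powr p) * indicator E z \<le> (case z of (a, b) \<Rightarrow> ennreal (dist a b powr p))"
  proof eventually_elim
    case (elim z)
    then show ?case using sep[of "fst z" "snd z"] e p
      by (auto simp: E_def indicator_def split: prod.split intro!: ennreal_leI powr_mono2)
  qed
  have "ennreal (e powr p * \<bar>measure \<mu> P - measure \<nu> P\<bar>) \<le> ennreal (e powr p * prob E)"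
    using pE by (intro ennreal_leI mult_left_mono) auto
  also have "\<dots> = (\<integral>\<^sup>+ z. ennreal (e powr p) * indicator E z \<partial>\<gamma>)"
    using E by (simp add: nn_integral_cmult_indicator emeasure_eq_measure ennreal_mult)
  also have "\<dots> \<le> (\<integral>\<^sup>+ z. (case z of (a, b) \<Rightarrow> ennreal (dist a b powr p)) \<partial>\<gamma>)"
    using ae by (rule nn_integral_mono_AE)
  finally show ?thesis .
qed

text \<open>As \<open>enn2real\<close> sends infinity to \<open>0\<close>, a lower bound for the
  infimum passes to the real number only once the infimum is finite. The coupling of finite cost
  guarantees that.\<close>

lemma wasserstein_dist_ge:
  assumes "0 < p" "0 \<le> c"
    and "\<gamma> \<in> couplings \<mu> \<nu>" "(\<integral>\<^sup>+ (a, b). ennreal (dist a b powr p) \<partial>\<gamma>) < \<infinity>"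
    and "\<And>\<gamma>. \<gamma> \<in> couplings \<mu> \<nu> \<Longrightarrow> ennreal c \<le> (\<integral>\<^sup>+ (a, b). ennreal (dist a b powr p) \<partial>\<gamma>)"
  shows "c powr (1 / p) \<le> wasserstein_dist p \<mu> \<nu>"
proof -
  let ?I = "INF \<gamma> \<in> couplings \<mu> \<nu>. \<integral>\<^sup>+ (a, b). ennreal (dist a b powr p) \<partial>\<gamma>"
  have "ennreal c \<le> ?I" using assms(5) by (rule INF_greatest)
  moreover have "?I < top"
    using INF_lower[OF assms(3)] assms(4) unfolding infinity_ennreal_def by (rule order.strict_trans1)
  ultimately have "enn2real (ennreal c) \<le> enn2real ?I" by (rule enn2real_mono)
  then have "c \<le> enn2real ?I" using assms(2) by simp
  then show ?thesis unfolding wasserstein_dist_def using assms(1,2) by (intro powr_mono2) auto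
qed

text \<open>
  Sending the mass outside \<open>A\<close> to the base point \<open>q\<close> makes the mass of a point of \<open>A\<close>
  independent of the cardinality of \<open>A\<close>.
\<close>
definition collapsed_uniform :: "'a::metric_space set \<Rightarrow> 'a \<Rightarrow> 'a set \<Rightarrow> 'a measure" where
  "collapsed_uniform S q A = distr (measure_pmf (pmf_of_set S)) borel (\<lambda>x. if x \<in> A then x else q)"

lemma collapsed_uniform_in_borel_prob_measures: "collapsed_uniform S q A \<in> borel_prob_measures"
  unfolding collapsed_uniform_def borel_prob_measures_def
  by (auto intro!: prob_space.prob_space_distr prob_space_measure_pmf)

text \<open>\<open>coupling_cost_ge\<close> is tested on \<open>A - B\<close> and on
  \<open>B - A\<close>: each point of these sets has mass \<open>1 / card S\<close> under one
  measure and \<open>0\<close> under the other. The better test sees at least half of the symmetric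
  difference, whence the factor \<open>2\<close>.\<close>

lemma wasserstein_dist_collapsed_uniform_ge:
  assumes S: "finite S" "q \<in> S" "A \<subseteq> S - {q}" "B \<subseteq> S - {q}"
    and p: "0 < p" and e: "0 < e"
    and sep: "\<And>x y. x \<in> S \<Longrightarrow> y \<in> S \<Longrightarrow> x \<noteq> y \<Longrightarrow> e \<le> dist x y"
  shows "e * (real (card (sym_diff A B)) / (2 * real (card S))) powr (1 / p)
     \<le> wasserstein_dist p (collapsed_uniform S q A) (collapsed_uniform S q B)"
proof -
  let ?U = "measure_pmf (pmf_of_set S)"
  let ?s = "\<lambda>A x. if x \<in> A then x else q"
  have ne: "S \<noteq> {}" using S by auto
  have em: "emeasure (collapsed_uniform S q A) Q = ennreal (card (S \<inter> ?s A -` Q) / card S)"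
    if "Q \<in> sets borel" for A Q
    unfolding collapsed_uniform_def using that S(1) ne
    by (simp add: emeasure_distr measure_pmf.emeasure_eq_measure measure_pmf_of_set)
  have me: "measure (collapsed_uniform S q A) Q = card (S \<inter> ?s A -` Q) / card S"
    if "Q \<in> sets borel" for A Q
    unfolding measure_def using em[OF that] by simp
  have Sb: "Q \<in> sets borel" if "Q \<subseteq> S" for Q
    using that S(1) by (meson borel_closed finite_imp_closed finite_subset)
  have one: "emeasure (collapsed_uniform S q A) S = 1" if "A \<subseteq> S - {q}" for A
  proof -
    have "S \<inter> ?s A -` S = S" using that S(2) by auto
    then show ?thesis using em[OF Sb[OF order_refl]] ne S(1) by simp
  qed
  have full: "S \<inter> ?s A -` (A - B) = A - B" "S \<inter> ?s B -` (A - B) = {}"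
    "S \<inter> ?s B -` (B - A) = B - A" "S \<inter> ?s A -` (B - A) = {}"
    using S by (auto split: if_splits)
  let ?c = "e powr p * (real (card (sym_diff A B)) / (2 * real (card S)))"
  \<comment> \<open>Sending one uniform random point through both collapsing maps couples the two
    measures. The cost is a finite sum, so the infimum is finite.\<close>
  define \<gamma> where "\<gamma> = distr ?U borel (\<lambda>x. (?s A x, ?s B x))"
  have fst: "fst \<in> measurable (borel :: ('a \<times> 'a) measure) borel" and snd: "snd \<in> measurable (borel :: ('a \<times> 'a) measure) borel"
    by (intro borel_measurable_continuous_onI continuous_intros)+
  have \<gamma>: "\<gamma> \<in> couplings (collapsed_uniform S q A) (collapsed_uniform S q B)"
    unfolding couplings_def borel_prob_measures_def \<gamma>_def collapsed_uniform_def
    using distr_distr[OF fst, of "\<lambda>x. (?s A x, ?s B x)" ?U] distr_distr[OF snd, of "\<lambda>x. (?s A x, ?s B x)" ?U]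
    by (auto intro!: prob_space.prob_space_distr prob_space_measure_pmf simp: o_def)
  have "ennreal ?c \<le> (\<integral>\<^sup>+ (a, b). ennreal (dist a b powr p) \<partial>\<gamma>)"
    if \<gamma>: "\<gamma> \<in> couplings (collapsed_uniform S q A) (collapsed_uniform S q B)" for \<gamma>
  proof -
    note ge = coupling_cost_ge[OF \<gamma> p e Sb[OF order_refl] one[OF S(3)] one[OF S(4)] sep]
    have "real (card (A - B)) / card S \<le> \<bar>measure (collapsed_uniform S q A) (A - B) - measure (collapsed_uniform S q B) (A - B)\<bar>"
      using S by (subst (1 2) me) (auto intro!: Sb simp del: vimage_Diff simp: full)
    then have 1: "ennreal (e powr p * (real (card (A - B)) / card S)) \<le> (\<integral>\<^sup>+ (a, b). ennreal (dist a b powr p) \<partial>\<gamma>)"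
      using S by (intro order_trans[OF _ ge[of "A - B"]] ennreal_leI mult_left_mono Sb) auto
    have "real (card (B - A)) / card S \<le> \<bar>measure (collapsed_uniform S q A) (B - A) - measure (collapsed_uniform S q B) (B - A)\<bar>"
      using S by (subst (1 2) me) (auto intro!: Sb simp del: vimage_Diff simp: full)
    then have 2: "ennreal (e powr p * (real (card (B - A)) / card S)) \<le> (\<integral>\<^sup>+ (a, b). ennreal (dist a b powr p) \<partial>\<gamma>)"
      using S by (intro order_trans[OF _ ge[of "B - A"]] ennreal_leI mult_left_mono Sb) auto
    have "finite A" "finite B" using S by (auto intro: finite_subset)
    then have "card (sym_diff A B) = card (A - B) + card (B - A)" by (intro card_Un_disjoint) auto
    then have "real (card (sym_diff A B)) / (2 * real (card S)) \<le> max (real (card (A - B)) / card S) (real (card (B - A)) / card S)"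
      using ne S(1) by (simp add: max_def field_simps card_gt_0_iff)
    then have "?c \<le> max (e powr p * (real (card (A - B)) / card S)) (e powr p * (real (card (B - A)) / card S))"
      using mult_left_mono[of _ _ "e powr p"] by (fastforce simp: le_max_iff_disj)
    then have "ennreal ?c \<le> ennreal (max (e powr p * (real (card (A - B)) / card S)) (e powr p * (real (card (B - A)) / card S)))"
      by (rule ennreal_leI)
    also have "\<dots> \<le> (\<integral>\<^sup>+ (a, b). ennreal (dist a b powr p) \<partial>\<gamma>)"
      using 1 2 unfolding max_def by presburger
    finally show ?thesis .
  qed
  moreover have "(\<integral>\<^sup>+ (a, b). ennreal (dist a b powr p) \<partial>\<gamma>) < \<infinity>"
  proof -
    have "(\<lambda>z::'a\<times>'a. dist (fst z) (snd z)) \<in> borel_measurable borel"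
      by (intro borel_measurable_continuous_onI continuous_intros)
    then have "(\<lambda>z::'a\<times>'a. dist (fst z) (snd z) powr p) \<in> borel_measurable borel" by measurable
    then have "(\<integral>\<^sup>+ (a, b). ennreal (dist a b powr p) \<partial>\<gamma>) = (\<integral>\<^sup>+ x. ennreal (dist (?s A x) (?s B x) powr p) \<partial>?U)"
      unfolding \<gamma>_def case_prod_beta by (subst nn_integral_distr) auto
    also have "\<dots> < \<infinity>"
      using S(1) ne by (subst nn_integral_measure_pmf_support[of S]) (auto simp: ennreal_mult[symmetric])
    finally show ?thesis .
  qed
  ultimately have "?c powr (1 / p) \<le> wasserstein_dist p (collapsed_uniform S q A) (collapsed_uniform S q B)"
    using \<gamma> p by (intro wasserstein_dist_ge) auto
  moreover have "?c powr (1 / p) = e * (real (card (sym_diff A B)) / (2 * real (card S))) powr (1 / p)"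
    using e p by (subst powr_mult) (auto simp: powr_powr)
  ultimately show ?thesis by simp
qed

section \<open>Upper bounds from the masses of cells\<close>

text \<open>The entry \<open>q i j\<close> is the mass to be sent from cell \<open>i\<close> to cell
  \<open>j\<close>. It is spread over \<open>B i \<times> B j\<close> proportionally to the product
  measure, so the marginals come out as \<open>\<mu>\<close> and \<open>\<nu>\<close> themselves and
  do not merely have the right cell masses.\<close>

lemma ex_coupling_of_matrix:
  fixes \<mu> \<nu> :: "'a::metric_space measure" and q :: "'i \<Rightarrow> 'i \<Rightarrow> real"
  assumes cpt: "compact (UNIV :: 'a set)"
    and \<mu>: "\<mu> \<in> borel_prob_measures" and \<nu>: "\<nu> \<in> borel_prob_measures"
    and I: "finite I" "disjoint_family_on B I" "(\<Union>i\<in>I. B i) = UNIV" "\<And>i. i \<in> I \<Longrightarrow> B i \<in> sets borel"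
    and q: "\<And>i j. i \<in> I \<Longrightarrow> j \<in> I \<Longrightarrow> 0 \<le> q i j"
      "\<And>i. i \<in> I \<Longrightarrow> (\<Sum>j\<in>I. q i j) = measure \<mu> (B i)"
      "\<And>j. j \<in> I \<Longrightarrow> (\<Sum>i\<in>I. q i j) = measure \<nu> (B j)"
    and K: "\<And>i j. i \<in> I \<Longrightarrow> j \<in> I \<Longrightarrow> 0 \<le> K i j"
      "\<And>i j x y. i \<in> I \<Longrightarrow> j \<in> I \<Longrightarrow> x \<in> B i \<Longrightarrow> y \<in> B j \<Longrightarrow> dist x y powr p \<le> K i j"
    and p: "0 < p"
  shows "\<exists>\<gamma>\<in>couplings \<mu> \<nu>. (\<integral>\<^sup>+ (a, b). ennreal (dist a b powr p) \<partial>\<gamma>) \<le> ennreal (\<Sum>i\<in>I. \<Sum>j\<in>I. q i j * K i j)"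
proof -
  have s\<mu>: "sets \<mu> = sets borel" and s\<nu>: "sets \<nu> = sets borel"
    using \<mu> \<nu> by (auto simp: borel_prob_measures_def)
  interpret M: prob_space \<mu> using \<mu> by (auto simp: borel_prob_measures_def)
  interpret N: prob_space \<nu> using \<nu> by (auto simp: borel_prob_measures_def)
  have sp: "space \<mu> = UNIV" "space \<nu> = UNIV"
    using sets_eq_imp_space_eq[OF s\<mu>] sets_eq_imp_space_eq[OF s\<nu>] by simp_all
  have sprod: "sets (\<mu> \<Otimes>\<^sub>M \<nu>) = sets borel"
    using sets_pair_measure_cong[OF s\<mu> s\<nu>] compact_imp_borel_prod[OF cpt] by simp
  \<comment> \<open>If a cell is null then the quotient is \<open>0\<close>, consistently with \<open>q i j = 0\<close>.\<close>
  define c where "c i j = q i j / (measure \<mu> (B i) * measure \<nu> (B j))" for i j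
  have q0: "q i j = 0" if "i \<in> I" "j \<in> I" "measure \<mu> (B i) = 0 \<or> measure \<nu> (B j) = 0" for i j
  proof -
    have "q i j \<le> measure \<mu> (B i)" unfolding q(2)[OF that(1), symmetric]
      using that q(1) I(1) by (intro member_le_sum) auto
    moreover have "q i j \<le> measure \<nu> (B j)" unfolding q(3)[OF that(2), symmetric]
      using that q(1) I(1) by (intro member_le_sum[of i I "\<lambda>i. q i j"]) auto
    ultimately show ?thesis using that q(1)[of i j] by auto
  qed
  have c0: "0 \<le> c i j" if "i \<in> I" "j \<in> I" for i j using q(1)[OF that] by (simp add: c_def)
  have cq: "c i j * (measure \<mu> (B i) * measure \<nu> (B j)) = q i j" if "i \<in> I" "j \<in> I" for i j
    using q0[OF that] by (auto simp: c_def)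
  define g where "g z = (\<Sum>i\<in>I. \<Sum>j\<in>I. ennreal (c i j) * indicator (B i \<times> B j) z)" for z
  have BB: "B i \<times> B j \<in> sets (\<mu> \<Otimes>\<^sub>M \<nu>)" if "i \<in> I" "j \<in> I" for i j
    using I(4) that s\<mu> s\<nu> by (intro pair_measureI) auto
  have gm: "g \<in> borel_measurable (\<mu> \<Otimes>\<^sub>M \<nu>)"
    unfolding g_def using BB by (intro borel_measurable_sum) auto
  define \<gamma> where "\<gamma> = density (\<mu> \<Otimes>\<^sub>M \<nu>) g"
  have s\<gamma>: "sets \<gamma> = sets borel" unfolding \<gamma>_def by (simp add: sprod)
  have sp\<gamma>: "space \<gamma> = UNIV" using sets_eq_imp_space_eq[OF s\<gamma>] by simp
  \<comment> \<open>Values on rectangles determine the marginals: the preimages under the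
    projections are \<open>X \<times> UNIV\<close> and \<open>UNIV \<times> X\<close>.\<close>
  have rect: "emeasure \<gamma> (X \<times> Y) = ennreal (\<Sum>i\<in>I. \<Sum>j\<in>I. c i j * (measure \<mu> (B i \<inter> X) * measure \<nu> (B j \<inter> Y)))"
    if "X \<in> sets borel" "Y \<in> sets borel" for X Y
  proof -
    have XY: "X \<times> Y \<in> sets (\<mu> \<Otimes>\<^sub>M \<nu>)" using that s\<mu> s\<nu> by (intro pair_measureI) auto
    have "emeasure \<gamma> (X \<times> Y) = (\<integral>\<^sup>+ z. g z * indicator (X \<times> Y) z \<partial>(\<mu> \<Otimes>\<^sub>M \<nu>))"
      unfolding \<gamma>_def using gm XY by (rule emeasure_density)
    also have "\<dots> = (\<integral>\<^sup>+ z. (\<Sum>i\<in>I. \<Sum>j\<in>I. ennreal (c i j) * indicator ((B i \<inter> X) \<times> (B j \<inter> Y)) z) \<partial>(\<mu> \<Otimes>\<^sub>M \<nu>))"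
      unfolding g_def sum_distrib_right
      by (intro nn_integral_cong sum.cong refl) (auto simp: indicator_def)
    also have "\<dots> = (\<Sum>i\<in>I. \<Sum>j\<in>I. ennreal (c i j) * emeasure (\<mu> \<Otimes>\<^sub>M \<nu>) ((B i \<inter> X) \<times> (B j \<inter> Y)))"
    proof -
      have R: "(B i \<inter> X) \<times> (B j \<inter> Y) \<in> sets (\<mu> \<Otimes>\<^sub>M \<nu>)" if "i \<in> I" "j \<in> I" for i j
        using I(4) that \<open>X \<in> _\<close> \<open>Y \<in> _\<close> s\<mu> s\<nu> by (intro pair_measureI) auto
      then have S: "(\<lambda>z. \<Sum>j\<in>I. ennreal (c i j) * indicator ((B i \<inter> X) \<times> (B j \<inter> Y)) z) \<in> borel_measurable (\<mu> \<Otimes>\<^sub>M \<nu>)"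
        if "i \<in> I" for i using that by (intro borel_measurable_sum) auto
      show ?thesis
        using R S by (subst nn_integral_sum; (intro sum.cong refl)?) (auto simp: nn_integral_sum nn_integral_cmult_indicator)
    qed
    also have "\<dots> = (\<Sum>i\<in>I. \<Sum>j\<in>I. ennreal (c i j * (measure \<mu> (B i \<inter> X) * measure \<nu> (B j \<inter> Y))))"
    proof (intro sum.cong refl)
      fix i j assume ij: "i \<in> I" "j \<in> I"
      have "emeasure (\<mu> \<Otimes>\<^sub>M \<nu>) ((B i \<inter> X) \<times> (B j \<inter> Y)) = emeasure \<mu> (B i \<inter> X) * emeasure \<nu> (B j \<inter> Y)"
        using I(4) ij that s\<mu> s\<nu> by (intro N.emeasure_pair_measure_Times) auto
      then show "ennreal (c i j) * emeasure (\<mu> \<Otimes>\<^sub>M \<nu>) ((B i \<inter> X) \<times> (B j \<inter> Y))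
        = ennreal (c i j * (measure \<mu> (B i \<inter> X) * measure \<nu> (B j \<inter> Y)))"
        using c0[OF ij] by (simp add: M.emeasure_eq_measure N.emeasure_eq_measure ennreal_mult)
    qed
    also have "\<dots> = ennreal (\<Sum>i\<in>I. \<Sum>j\<in>I. c i j * (measure \<mu> (B i \<inter> X) * measure \<nu> (B j \<inter> Y)))"
      using c0 by (simp add: sum_nonneg)
    finally show ?thesis .
  qed
  have split\<mu>: "measure \<mu> X = (\<Sum>i\<in>I. measure \<mu> (B i \<inter> X))" if "X \<in> sets borel" for X
  proof -
    have "X = (\<Union>i\<in>I. B i \<inter> X)" using I(3) by auto
    moreover have "measure \<mu> (\<Union>i\<in>I. B i \<inter> X) = (\<Sum>i\<in>I. measure \<mu> (B i \<inter> X))"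
      using I that s\<mu> by (intro M.finite_measure_finite_Union) (auto simp: disjoint_family_on_def)
    ultimately show ?thesis by simp
  qed
  have split\<nu>: "measure \<nu> X = (\<Sum>i\<in>I. measure \<nu> (B i \<inter> X))" if "X \<in> sets borel" for X
  proof -
    have "X = (\<Union>i\<in>I. B i \<inter> X)" using I(3) by auto
    moreover have "measure \<nu> (\<Union>i\<in>I. B i \<inter> X) = (\<Sum>i\<in>I. measure \<nu> (B i \<inter> X))"
      using I that s\<nu> by (intro N.finite_measure_finite_Union) (auto simp: disjoint_family_on_def)
    ultimately show ?thesis by simp
  qed
  have sub: "measure \<mu> (B i \<inter> X) \<le> measure \<mu> (B i)" "measure \<nu> (B i \<inter> X) \<le> measure \<nu> (B i)" if "i \<in> I" for i X
    using I(4)[OF that] s\<mu> s\<nu> by (auto intro!: M.finite_measure_mono N.finite_measure_mono)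
  have fstm: "fst \<in> measurable \<gamma> borel" and sndm: "snd \<in> measurable \<gamma> borel"
    unfolding measurable_cong_sets[OF s\<gamma> refl]
    by (intro borel_measurable_continuous_onI continuous_intros)+
  have d1: "distr \<gamma> borel fst = \<mu>"
  proof (rule measure_eqI)
    fix X assume "X \<in> sets (distr \<gamma> borel fst)"
    then have X: "X \<in> sets borel" by simp
    have "emeasure (distr \<gamma> borel fst) X = emeasure \<gamma> (X \<times> UNIV)"
      using X fstm sp\<gamma> by (simp add: emeasure_distr fst_vimage_eq_Times)
    also have "\<dots> = ennreal (\<Sum>i\<in>I. \<Sum>j\<in>I. c i j * (measure \<mu> (B i \<inter> X) * measure \<nu> (B j)))"
      using rect[OF X, of UNIV] by simp
    also have "(\<Sum>i\<in>I. \<Sum>j\<in>I. c i j * (measure \<mu> (B i \<inter> X) * measure \<nu> (B j))) = (\<Sum>i\<in>I. measure \<mu> (B i \<inter> X))"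
    proof (rule sum.cong[OF refl])
      fix i assume i: "i \<in> I"
      have "(\<Sum>j\<in>I. c i j * (measure \<mu> (B i \<inter> X) * measure \<nu> (B j))) = (\<Sum>j\<in>I. measure \<mu> (B i \<inter> X) / measure \<mu> (B i) * q i j)"
        using q0[OF i] by (intro sum.cong refl) (auto simp: c_def)
      \<comment> \<open>The sum of row \<open>i\<close> cancels the denominator. In a null cell both
        sides are \<open>0\<close>, because \<open>B i \<inter> X\<close> is null as well.\<close>
      also have "\<dots> = measure \<mu> (B i \<inter> X)"
        using sub(1)[OF i, of X] measure_nonneg[of \<mu> "B i \<inter> X"]
        unfolding sum_distrib_left[symmetric] q(2)[OF i] by (cases "measure \<mu> (B i) = 0") auto
      finally show "(\<Sum>j\<in>I. c i j * (measure \<mu> (B i \<inter> X) * measure \<nu> (B j))) = measure \<mu> (B i \<inter> X)" .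
    qed
    finally show "emeasure (distr \<gamma> borel fst) X = emeasure \<mu> X"
      using split\<mu>[OF X] by (simp add: M.emeasure_eq_measure)
  qed (simp add: s\<mu>)
  have d2: "distr \<gamma> borel snd = \<nu>"
  proof (rule measure_eqI)
    fix X assume "X \<in> sets (distr \<gamma> borel snd)"
    then have X: "X \<in> sets borel" by simp
    have "emeasure (distr \<gamma> borel snd) X = emeasure \<gamma> (UNIV \<times> X)"
      using X sndm sp\<gamma> by (simp add: emeasure_distr snd_vimage_eq_Times)
    also have "\<dots> = ennreal (\<Sum>i\<in>I. \<Sum>j\<in>I. c i j * (measure \<mu> (B i) * measure \<nu> (B j \<inter> X)))"
      using rect[OF _ X, of UNIV] by simp
    also have "(\<Sum>i\<in>I. \<Sum>j\<in>I. c i j * (measure \<mu> (B i) * measure \<nu> (B j \<inter> X))) = (\<Sum>j\<in>I. \<Sum>i\<in>I. c i j * (measure \<mu> (B i) * measure \<nu> (B j \<inter> X)))"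
      by (rule sum.swap)
    also have "\<dots> = (\<Sum>j\<in>I. measure \<nu> (B j \<inter> X))"
    proof (rule sum.cong[OF refl])
      fix j assume j: "j \<in> I"
      have "(\<Sum>i\<in>I. c i j * (measure \<mu> (B i) * measure \<nu> (B j \<inter> X))) = (\<Sum>i\<in>I. measure \<nu> (B j \<inter> X) / measure \<nu> (B j) * q i j)"
        using q0[OF _ j] by (intro sum.cong refl) (auto simp: c_def)
      also have "\<dots> = measure \<nu> (B j \<inter> X)"
        using sub(2)[OF j, of X] measure_nonneg[of \<nu> "B j \<inter> X"]
        unfolding sum_distrib_left[symmetric] q(3)[OF j] by (cases "measure \<nu> (B j) = 0") auto
      finally show "(\<Sum>i\<in>I. c i j * (measure \<mu> (B i) * measure \<nu> (B j \<inter> X))) = measure \<nu> (B j \<inter> X)" .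
    qed
    finally show "emeasure (distr \<gamma> borel snd) X = emeasure \<nu> X"
      using split\<nu>[OF X] by (simp add: N.emeasure_eq_measure)
  qed (simp add: s\<nu>)
  have "prob_space \<gamma>"
  proof (rule prob_spaceI)
    have "emeasure \<gamma> (space \<gamma>) = emeasure (distr \<gamma> borel fst) (space \<mu>)"
      using fstm sp sp\<gamma> by (simp add: emeasure_distr)
    then show "emeasure \<gamma> (space \<gamma>) = 1" using d1 M.emeasure_space_1 by simp
  qed
  then have in_c: "\<gamma> \<in> couplings \<mu> \<nu>"
    using d1 d2 s\<gamma> by (auto simp: couplings_def borel_prob_measures_def)
  have "(\<lambda>z::'a\<times>'a. dist (fst z) (snd z)) \<in> borel_measurable borel"
    by (intro borel_measurable_continuous_onI continuous_intros)
  then have "(\<lambda>z::'a\<times>'a. ennreal (dist (fst z) (snd z) powr p)) \<in> borel_measurable borel" by measurable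
  then have dm: "(\<lambda>z::'a\<times>'a. ennreal (dist (fst z) (snd z) powr p)) \<in> borel_measurable (\<mu> \<Otimes>\<^sub>M \<nu>)"
    unfolding measurable_cong_sets[OF sprod refl] .
  have "(\<integral>\<^sup>+ (a, b). ennreal (dist a b powr p) \<partial>\<gamma>) = (\<integral>\<^sup>+ z. g z * ennreal (dist (fst z) (snd z) powr p) \<partial>(\<mu> \<Otimes>\<^sub>M \<nu>))"
    unfolding \<gamma>_def case_prod_beta using gm dm by (rule nn_integral_density)
  also have "\<dots> \<le> (\<integral>\<^sup>+ z. (\<Sum>i\<in>I. \<Sum>j\<in>I. ennreal (c i j * K i j) * indicator (B i \<times> B j) z) \<partial>(\<mu> \<Otimes>\<^sub>M \<nu>))"
    unfolding g_def sum_distrib_right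
  proof (intro nn_integral_mono sum_mono)
    fix z i j assume ij: "i \<in> I" "j \<in> I"
    show "ennreal (c i j) * indicator (B i \<times> B j) z * ennreal (dist (fst z) (snd z) powr p)
      \<le> ennreal (c i j * K i j) * indicator (B i \<times> B j) z"
      using K(2)[OF ij, of "fst z" "snd z"] c0[OF ij] K(1)[OF ij]
      by (auto simp: indicator_def ennreal_mult[symmetric] intro!: ennreal_leI mult_left_mono)
  qed
  also have "\<dots> = (\<Sum>i\<in>I. \<Sum>j\<in>I. ennreal (c i j * K i j) * emeasure (\<mu> \<Otimes>\<^sub>M \<nu>) (B i \<times> B j))"
  proof -
    have S: "(\<lambda>z. \<Sum>j\<in>I. ennreal (c i j * K i j) * indicator (B i \<times> B j) z) \<in> borel_measurable (\<mu> \<Otimes>\<^sub>M \<nu>)"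
      if "i \<in> I" for i using that BB by (intro borel_measurable_sum) auto
    show ?thesis
      using BB S by (subst nn_integral_sum; (intro sum.cong refl)?) (auto simp: nn_integral_sum nn_integral_cmult_indicator)
  qed
  also have "\<dots> = (\<Sum>i\<in>I. \<Sum>j\<in>I. ennreal (q i j * K i j))"
  proof (intro sum.cong refl)
    fix i j assume ij: "i \<in> I" "j \<in> I"
    have "emeasure (\<mu> \<Otimes>\<^sub>M \<nu>) (B i \<times> B j) = emeasure \<mu> (B i) * emeasure \<nu> (B j)"
      using I(4) ij s\<mu> s\<nu> by (intro N.emeasure_pair_measure_Times) auto
    then have "ennreal (c i j * K i j) * emeasure (\<mu> \<Otimes>\<^sub>M \<nu>) (B i \<times> B j)
      = ennreal (c i j * K i j * (measure \<mu> (B i) * measure \<nu> (B j)))"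
      using c0[OF ij] K(1)[OF ij] by (simp add: M.emeasure_eq_measure N.emeasure_eq_measure ennreal_mult)
    also have "c i j * K i j * (measure \<mu> (B i) * measure \<nu> (B j)) = q i j * K i j"
      using cq[OF ij] by (simp add: mult.commute mult.left_commute)
    finally show "ennreal (c i j * K i j) * emeasure (\<mu> \<Otimes>\<^sub>M \<nu>) (B i \<times> B j) = ennreal (q i j * K i j)" .
  qed
  also have "\<dots> = ennreal (\<Sum>i\<in>I. \<Sum>j\<in>I. q i j * K i j)"
    using q(1) K(1) by (simp add: sum_nonneg)
  finally show ?thesis using in_c by blast
qed

lemma wasserstein_dist_le:
  assumes "0 < p" "0 \<le> c" "\<gamma> \<in> couplings \<mu> \<nu>"
    and "(\<integral>\<^sup>+ (a, b). ennreal (dist a b powr p) \<partial>\<gamma>) \<le> ennreal c"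
  shows "wasserstein_dist p \<mu> \<nu> \<le> c powr (1 / p)"
proof -
  let ?I = "INF \<gamma> \<in> couplings \<mu> \<nu>. \<integral>\<^sup>+ (a, b). ennreal (dist a b powr p) \<partial>\<gamma>"
  have "?I \<le> ennreal c"
    using assms(4) by (rule INF_lower2[OF assms(3)])
  then have "enn2real ?I \<le> c" using assms(2) by (rule enn2real_leI[rotated])
  then show ?thesis unfolding wasserstein_dist_def using assms(1) by (intro powr_mono2) auto
qed

text \<open>In each cell the common mass stays and moves by at most \<open>d\<close>. The excess has
  total mass at most \<open>card I * h\<close> and moves by at most \<open>D\<close>.\<close>

lemma wasserstein_dist_le_partition:
  fixes \<mu> \<nu> :: "'a::metric_space measure" and B :: "'i \<Rightarrow> 'a set"
  assumes cpt: "compact (UNIV :: 'a set)"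
    and \<mu>: "\<mu> \<in> borel_prob_measures" and \<nu>: "\<nu> \<in> borel_prob_measures"
    and I: "finite I" "disjoint_family_on B I" "(\<Union>i\<in>I. B i) = UNIV" "\<And>i. i \<in> I \<Longrightarrow> B i \<in> sets borel"
    and p: "0 < p" and d: "0 \<le> d" "d \<le> D"
    and diam: "\<And>i x y. i \<in> I \<Longrightarrow> x \<in> B i \<Longrightarrow> y \<in> B i \<Longrightarrow> dist x y \<le> d"
    and D: "\<And>x y :: 'a. dist x y \<le> D"
    and close: "\<And>i. i \<in> I \<Longrightarrow> \<bar>measure \<mu> (B i) - measure \<nu> (B i)\<bar> \<le> h"
  shows "wasserstein_dist p \<mu> \<nu> \<le> (d powr p + real (card I) * h * D powr p) powr (1 / p)"
proof -
  define u where "u i = measure \<mu> (B i)" for i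
  define v where "v i = measure \<nu> (B i)" for i
  define m where "m i = min (u i) (v i)" for i
  define r where "r = (\<Sum>i\<in>I. u i - m i)"
  have tot: "(\<Sum>i\<in>I. measure M (B i)) = 1" if "M \<in> borel_prob_measures" for M :: "'a measure"
  proof -
    interpret prob_space M using that by (simp add: borel_prob_measures_def)
    have "sets M = sets borel" using that by (simp add: borel_prob_measures_def)
    then have "measure M (\<Union>i\<in>I. B i) = (\<Sum>i\<in>I. measure M (B i))"
      using I by (intro finite_measure_finite_Union) auto
    then show ?thesis using I(3) prob_space sets_eq_imp_space_eq[OF \<open>sets M = sets borel\<close>] by simp
  qed
  have tu: "(\<Sum>i\<in>I. u i) = 1" "(\<Sum>i\<in>I. v i) = 1" unfolding u_def v_def by (rule tot[OF \<mu>], rule tot[OF \<nu>])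
  \<comment> \<open>Both measures have total mass \<open>1\<close>, so their excesses have the same
    total and can be matched.\<close>
  have r': "r = (\<Sum>i\<in>I. v i - m i)" unfolding r_def by (simp add: sum_subtractf tu)
  have nn: "0 \<le> u i - m i" "0 \<le> v i - m i" "0 \<le> m i" for i
    by (auto simp: m_def u_def v_def)
  have r0: "0 \<le> r" unfolding r_def by (intro sum_nonneg nn)
  have z: "u i - m i = 0" "v i - m i = 0" if "i \<in> I" "r = 0" for i
  proof -
    have "(\<Sum>i\<in>I. u i - m i) = 0" "(\<Sum>i\<in>I. v i - m i) = 0" using that r' r_def by auto
    then show "u i - m i = 0" "v i - m i = 0" using that(1) sum_nonneg_eq_0_iff[OF I(1)] nn by meson+
  qed
  have rle: "r \<le> real (card I) * h"
  proof -
    have "u i - m i \<le> h" if "i \<in> I" for i using close[OF that] by (auto simp: u_def v_def m_def)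
    then have "r \<le> (\<Sum>i\<in>I. h)" unfolding r_def by (intro sum_mono)
    then show ?thesis by simp
  qed
  \<comment> \<open>The common mass \<open>m i\<close> stays in its cell and the excesses are coupled independently;
    if \<open>r = 0\<close> there is no excess and \<open>s\<close> vanishes.\<close>
  define s where "s i j = (u i - m i) * (v j - m j) / r" for i j
  have s0: "0 \<le> s i j" for i j unfolding s_def using nn r0 by simp
  have srow: "(\<Sum>j\<in>I. s i j) = u i - m i" if "i \<in> I" for i
    unfolding s_def sum_divide_distrib[symmetric] sum_distrib_left[symmetric] r'[symmetric]
    using z(1)[OF that] by auto
  have scol: "(\<Sum>i\<in>I. s i j) = v j - m j" if "j \<in> I" for j
    unfolding s_def sum_divide_distrib[symmetric] sum_distrib_right[symmetric] r_def[symmetric]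
    using z(2)[OF that] by auto
  define q where "q i j = (if i = j then m i else 0) + s i j" for i j
  define K where "K i j = (if i = j then d powr p else D powr p)" for i j :: 'i
  \<comment> \<open>Every entry of \<open>s\<close>, the diagonal ones included, is charged at the
    rate \<open>D powr p\<close>; this uses \<open>d \<le> D\<close>.\<close>
  have Kle: "K i j \<le> D powr p" for i j using d p by (auto simp: K_def intro!: powr_mono2)
  have "\<exists>\<gamma>\<in>couplings \<mu> \<nu>. (\<integral>\<^sup>+ (a, b). ennreal (dist a b powr p) \<partial>\<gamma>) \<le> ennreal (\<Sum>i\<in>I. \<Sum>j\<in>I. q i j * K i j)"
  proof (rule ex_coupling_of_matrix[OF cpt \<mu> \<nu> I])
    show "0 \<le> q i j" for i j using nn s0 by (simp add: q_def)
    show "(\<Sum>j\<in>I. q i j) = measure \<mu> (B i)" if "i \<in> I" for i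
      using that I(1) by (simp add: q_def sum.distrib srow u_def)
    show "(\<Sum>i\<in>I. q i j) = measure \<nu> (B j)" if "j \<in> I" for j
      using that I(1) by (simp add: q_def sum.distrib scol v_def)
    show "0 \<le> K i j" for i j by (simp add: K_def)
    show "dist x y powr p \<le> K i j" if "i \<in> I" "j \<in> I" "x \<in> B i" "y \<in> B j" for i j x y
      using that diam D p by (auto simp: K_def intro!: powr_mono2)
  qed (use p in auto)
  then obtain \<gamma> where \<gamma>: "\<gamma> \<in> couplings \<mu> \<nu>"
    "(\<integral>\<^sup>+ (a, b). ennreal (dist a b powr p) \<partial>\<gamma>) \<le> ennreal (\<Sum>i\<in>I. \<Sum>j\<in>I. q i j * K i j)" by blast
  have "(\<Sum>i\<in>I. \<Sum>j\<in>I. q i j * K i j) \<le> (\<Sum>i\<in>I. \<Sum>j\<in>I. (if i = j then m i * d powr p else 0) + s i j * D powr p)"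
  proof (intro sum_mono)
    fix i j
    have "s i j * K i j \<le> s i j * D powr p" using Kle s0 by (rule mult_left_mono)
    then show "q i j * K i j \<le> (if i = j then m i * d powr p else 0) + s i j * D powr p"
      by (auto simp: q_def K_def distrib_right)
  qed
  also have "\<dots> = (\<Sum>i\<in>I. m i) * d powr p + r * D powr p"
    using I(1) by (simp add: sum.distrib sum_distrib_right[symmetric] srow r_def)
  also have "(\<Sum>i\<in>I. m i) \<le> 1" unfolding tu(1)[symmetric] by (intro sum_mono) (simp add: m_def)
  finally have "(\<Sum>i\<in>I. \<Sum>j\<in>I. q i j * K i j) \<le> 1 * d powr p + r * D powr p"
    by (simp add: mult_right_mono)
  also have "\<dots> \<le> d powr p + real (card I) * h * D powr p"
    using rle by (simp add: mult_right_mono)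
  finally have le: "(\<Sum>i\<in>I. \<Sum>j\<in>I. q i j * K i j) \<le> d powr p + real (card I) * h * D powr p" .
  have "0 \<le> d powr p + real (card I) * h * D powr p" using rle r0 by simp
  then show ?thesis
    using wasserstein_dist_le[OF p _ \<gamma>(1) order_trans[OF \<gamma>(2) ennreal_leI[OF le]]] by blast
qed

text \<open>Removing from each ball the earlier ones makes the cover disjoint and keeps the number
  of cells; some of them may become empty.\<close>

lemma ex_borel_partition:
  fixes C :: "'a::metric_space set"
  assumes "finite C" "UNIV \<subseteq> (\<Union>x\<in>C. ball x e)"
  shows "\<exists>B :: nat \<Rightarrow> 'a set. disjoint_family_on B {..<card C} \<and> (\<Union>i<card C. B i) = UNIV
    \<and> (\<forall>i. B i \<in> sets borel) \<and> (\<forall>i. \<forall>x\<in>B i. \<forall>y\<in>B i. dist x y \<le> 2 * e)"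
proof -
  obtain g where g: "bij_betw g {..<card C} C"
    using ex_bij_betw_nat_finite[OF assms(1)] by (auto simp: atLeast0LessThan)
  define B where "B = disjointed (\<lambda>i. ball (g i) e)"
  have sub: "B i \<subseteq> ball (g i) e" for i unfolding B_def by (rule disjointed_subset)
  have "(\<Union>i<card C. B i) = (\<Union>i<card C. ball (g i) e)"
    unfolding B_def using finite_UN_disjointed_eq[of _ "card C"] by (simp add: atLeast0LessThan)
  also have "\<dots> = (\<Union>x\<in>g ` {..<card C}. ball x e)" by simp
  also have "\<dots> = (\<Union>x\<in>C. ball x e)" by (simp only: bij_betw_imp_surj_on[OF g])
  finally have "(\<Union>i<card C. B i) = UNIV" using assms(2) by auto
  moreover have "disjoint_family_on B {..<card C}"
    unfolding B_def using disjoint_family_disjointed by (rule disjoint_family_on_mono[rotated]) simp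
  moreover have "B i \<in> sets borel" for i unfolding B_def disjointed_def by auto
  moreover have "dist x y \<le> 2 * e" if "x \<in> B i" "y \<in> B i" for i x y
    using subsetD[OF sub that(1)] subsetD[OF sub that(2)] dist_triangle3[of x y "g i"] by simp
  ultimately show ?thesis by (intro exI[of _ B]) auto
qed

section \<open>Sizes of separated families of measures\<close>

text \<open>Rounding the cell masses down to multiples of \<open>1 / K\<close> encodes a measure.
  Equal codes mean masses within \<open>1 / K\<close> in every cell, hence distance below
  \<open>r\<close>; so the encoding is injective on the family, and it remains to count
  codes.\<close>

lemma card_wasserstein_separated_le:
  fixes g :: "'i \<Rightarrow> 'a::metric_space measure"
  assumes cpt: "compact (UNIV :: 'a set)"
    and F: "finite F" "g ` F \<subseteq> borel_prob_measures"
    and C: "finite C" "(UNIV :: 'a set) \<subseteq> (\<Union>x\<in>C. ball x e)"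
    and p: "0 < p" and e: "0 < e" "2 * e \<le> D" and D: "\<And>x y :: 'a. dist x y \<le> D"
    and K: "0 < K"
    and r: "\<And>i j. i \<in> F \<Longrightarrow> j \<in> F \<Longrightarrow> i \<noteq> j \<Longrightarrow> r \<le> wasserstein_dist p (g i) (g j)"
      "((2 * e) powr p + real (card C) * (1 / real K) * D powr p) powr (1 / p) < r"
  shows "card F \<le> (K + 1) ^ card C"
proof -
  obtain B :: "nat \<Rightarrow> 'a set" where B: "disjoint_family_on B {..<card C}" "(\<Union>i<card C. B i) = UNIV"
    "\<And>i. B i \<in> sets borel" "\<And>i x y. x \<in> B i \<Longrightarrow> y \<in> B i \<Longrightarrow> dist x y \<le> 2 * e"
    using ex_borel_partition[OF C] by (elim exE conjE) (rule that, auto)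
  \<comment> \<open>\<open>restrict\<close> makes the codes extensional, so that they lie in a
    finite function space. A cell has \<open>K + 1\<close> possible values because mass
    \<open>1\<close> gives \<open>K\<close> itself.\<close>
  define code where "code i = restrict (\<lambda>k. nat \<lfloor>real K * measure (g i) (B k)\<rfloor>) {..<card C}" for i
  have "inj_on code F"
  proof (rule inj_onI, rule ccontr)
    fix i j assume ij: "i \<in> F" "j \<in> F" "code i = code j" "i \<noteq> j"
    have "\<bar>measure (g i) (B k) - measure (g j) (B k)\<bar> \<le> 1 / real K" if "k \<in> {..<card C}" for k
    proof -
      have "nat \<lfloor>real K * measure (g i) (B k)\<rfloor> = nat \<lfloor>real K * measure (g j) (B k)\<rfloor>"
        using fun_cong[OF ij(3), of k] that by (simp add: code_def)
      then have "\<lfloor>real K * measure (g i) (B k)\<rfloor> = \<lfloor>real K * measure (g j) (B k)\<rfloor>"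
        by (subst (asm) eq_nat_nat_iff) auto
      then have "\<bar>real K * measure (g i) (B k) - real K * measure (g j) (B k)\<bar> \<le> 1" by linarith
      then have "real K * \<bar>measure (g i) (B k) - measure (g j) (B k)\<bar> \<le> 1"
        unfolding right_diff_distrib[symmetric] abs_mult by simp
      then show ?thesis using K by (simp add: field_simps)
    qed
    then have "wasserstein_dist p (g i) (g j)
        \<le> ((2 * e) powr p + real (card {..<card C}) * (1 / real K) * D powr p) powr (1 / p)"
      using ij F(2) p e D B by (intro wasserstein_dist_le_partition[OF cpt, where B = B]) auto
    then show False using r(1)[OF ij(1,2,4)] r(2) by simp
  qed
  moreover have "code ` F \<subseteq> {..<card C} \<rightarrow>\<^sub>E {..K}"
  proof -
    have "nat \<lfloor>real K * measure (g i) (B k)\<rfloor> \<le> K" if "i \<in> F" for i k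
    proof -
      have "prob_space (g i)" using that F(2) by (auto simp: borel_prob_measures_def)
      then have "measure (g i) (B k) \<le> 1" by (rule prob_space.prob_le_1)
      then have "real K * measure (g i) (B k) \<le> real K * 1" by (intro mult_left_mono) auto
      then show ?thesis by linarith
    qed
    then show ?thesis by (auto simp: code_def PiE_def extensional_def)
  qed
  ultimately have "card F \<le> card ({..<card C} \<rightarrow>\<^sub>E {..K})"
    by (intro card_inj_on_le[of code]) (auto intro: finite_PiE)
  then show ?thesis by (simp add: card_PiE)
qed

text \<open>One point of \<open>S\<close> is the base point of \<open>collapsed_uniform\<close>,
  which leaves \<open>card S - 1\<close> points for the code. For \<open>1 \<le> p\<close> the root
  \<open>(1/16) powr (1 / p)\<close> is at least \<open>1/16\<close>, so the separation constant
  does not depend on \<open>p\<close>.\<close>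

lemma ex_large_wasserstein_separated_family:
  fixes S :: "'a::metric_space set"
  assumes p: "1 \<le> p" and e: "0 < e" and S: "finite S" "2 \<le> card S"
    and sep: "\<forall>x\<in>S. \<forall>y\<in>S. x \<noteq> y \<longrightarrow> e \<le> dist x y"
  shows "\<exists>(F :: 'a set set) (g :: 'a set \<Rightarrow> 'a measure). finite F \<and> (9/8) ^ (card S - 1) \<le> real (card F) \<and> g ` F \<subseteq> borel_prob_measures
    \<and> (\<forall>A\<in>F. \<forall>B\<in>F. A \<noteq> B \<longrightarrow> e / 16 \<le> wasserstein_dist p (g A) (g B))"
proof -
  obtain q where q: "q \<in> S" using S by fastforce
  have cT: "card (S - {q}) = card S - 1" using q S by simp
  have "finite (S - {q})" using S(1) by simp
  from ex_large_code[OF this] obtain F where F: "F \<subseteq> Pow (S - {q})"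
    "\<forall>A\<in>F. \<forall>B\<in>F. A \<noteq> B \<longrightarrow> card S - 1 \<le> 4 * card (sym_diff A B)"
    "(9/8) ^ (card S - 1) \<le> real (card F)"
    unfolding cT by (elim exE conjE) (rule that)
  have "e / 16 \<le> wasserstein_dist p (collapsed_uniform S q A) (collapsed_uniform S q B)"
    if "A \<in> F" "B \<in> F" "A \<noteq> B" for A B
  proof -
    let ?x = "real (card (sym_diff A B)) / (2 * real (card S))"
    \<comment> \<open>From \<open>2 \<le> card S\<close> it follows that \<open>card S - 1\<close>
      is at least \<open>card S / 2\<close>, which turns the \<open>4\<close> of the code into
      \<open>8\<close>.\<close>
    have "real (card S) \<le> 8 * real (card (sym_diff A B))" using F(2)[rule_format, OF that] S(2) by linarith
    then have "1/16 \<le> ?x" using S(2) by (simp add: field_simps)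
    then have "(1/16) powr (1 / p) \<le> ?x powr (1 / p)" using p by (intro powr_mono2) auto
    moreover have "(1/16 :: real) powr 1 \<le> (1/16) powr (1 / p)" using p by (intro powr_mono') auto
    ultimately have "e * (1/16) \<le> e * ?x powr (1 / p)" using e by (intro mult_left_mono) auto
    also have "\<dots> \<le> wasserstein_dist p (collapsed_uniform S q A) (collapsed_uniform S q B)"
      using F(1) that p e S(1) q sep by (intro wasserstein_dist_collapsed_uniform_ge) auto
    finally show ?thesis by simp
  qed
  moreover have "finite F" using F(1) S(1) by (meson finite_Diff finite_Pow_iff finite_subset)
  ultimately show ?thesis using F(3) collapsed_uniform_in_borel_prob_measures
    by (intro exI[of _ F] exI[of _ "collapsed_uniform S q"] conjI ballI impI) auto
qed

section \<open>Comparison of the two entropies\<close>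

theorem corollary1p6:
  fixes p p' :: real
  assumes "compact (UNIV :: 'a::metric_space set)"
    and "compact (UNIV :: 'b::metric_space set)"
    and "hausdorff_dimension (UNIV :: 'a set) > upper_minkowski_dimension (UNIV :: 'b set)"
    and "1 \<le> p" and "1 \<le> p'"
  shows "\<not> (\<exists>f :: 'a measure \<Rightarrow> 'b measure.
      bi_lipschitz_embedding
        borel_prob_measures (wasserstein_dist p)
        borel_prob_measures (wasserstein_dist p') f)"
proof
  assume "\<exists>f :: 'a measure \<Rightarrow> 'b measure.
      bi_lipschitz_embedding
        borel_prob_measures (wasserstein_dist p)
        borel_prob_measures (wasserstein_dist p') f"
  then obtain f :: "'a measure \<Rightarrow> 'b measure" and c where
    f: "f ` borel_prob_measures \<subseteq> borel_prob_measures" and c: "0 < c"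
    and low: "\<And>a b. a \<in> borel_prob_measures \<Longrightarrow> b \<in> borel_prob_measures
      \<Longrightarrow> c * wasserstein_dist p a b \<le> wasserstein_dist p' (f a) (f b)"
    unfolding bi_lipschitz_embedding_def by (elim exE conjE) (rule that, auto)
  obtain t where t: "upper_minkowski_dimension (UNIV :: 'b set) < ereal t" "ereal t < hausdorff_dimension (UNIV :: 'a set)"
    using ereal_dense2[OF assms(3)] by auto
  \<comment> \<open>Positivity of \<open>t\<close> passes to \<open>s\<close>, as
    \<open>ex_large_separated_set\<close> demands.\<close>
  have "0 < ereal t"
    using upper_minkowski_dimension_nonneg[OF assms(2)] t(1) by (rule order.strict_trans1) simp
  then have t0: "0 < t" by simp
  obtain s where s: "t < s" "ereal s < hausdorff_dimension (UNIV :: 'a set)"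
    using ereal_dense2[OF t(2)] by auto
  obtain D0 where D0: "\<And>x y :: 'b. dist x y \<le> D0"
    using compact_imp_bounded[OF assms(2)] by (metis UNIV_I bounded_two_points)
  \<comment> \<open>The lower bound \<open>1\<close> makes \<open>2 * d \<le> 1\<close> sufficient
    for \<open>2 * d \<le> D\<close>.\<close>
  define D where "D = max 1 D0"
  have D: "dist x y \<le> D" for x y :: 'b using D0[of x y] by (simp add: D_def)
  have D1: "1 \<le> D" by (simp add: D_def)
  define L where "L = (2 powr p' + D powr p') powr (1 / p')"
  have "0 < 2 powr p' + D powr p'" by (simp add: add_pos_nonneg)
  then have L: "0 < L" by (simp add: L_def)
  \<comment> \<open>The upper bound for the distance of measures with equal codes will read
    \<open>d * L\<close> at scale \<open>d\<close>. With \<open>d = k * e\<close> this is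
    \<open>c * e / 32\<close>, strictly below the separation \<open>c * (e / 16)\<close> of the
    image family.\<close>
  define k where "k = c / (32 * L)"
  have k: "0 < k" using c L by (simp add: k_def)
  \<comment> \<open>The cover of the target is taken at scale \<open>k * e\<close>, the separated
    set of the source at scale \<open>e\<close>.\<close>
  have "filterlim (\<lambda>e. k * e) (at_right 0) (at_right 0)" using k by real_asymp
  from eventually_compose_filterlim[OF card_cover_less_of_minkowski[OF assms(2) _ t(1)] this]
  have "eventually (\<lambda>e. \<exists>C. finite C \<and> (UNIV :: 'b set) \<subseteq> (\<Union>x\<in>C. ball x (k * e))
      \<and> real (card C) \<le> (1 / (k * e)) powr t) (at_right 0)" by simp
  moreover have "eventually (\<lambda>e. \<exists>A\<subseteq>UNIV :: 'a set. finite A \<and> (\<forall>x\<in>A. \<forall>y\<in>A. x \<noteq> y \<longrightarrow> e \<le> dist x y)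
      \<and> (1 / e) powr s \<le> real (card A)) (at_right 0)"
    using s t0 by (intro ex_large_separated_set) auto
  moreover have "eventually (\<lambda>e. 0 < e \<and> 2 * (k * e) \<le> 1 \<and> 2 \<le> (1 / e) powr s) (at_right 0)"
  proof (intro eventually_conj)
    show "eventually (\<lambda>e::real. 0 < e) (at_right 0)" by (simp add: eventually_at_right_less)
    show "eventually (\<lambda>e. 2 * (k * e) \<le> 1) (at_right 0)" using k by real_asymp
    show "eventually (\<lambda>e. 2 \<le> (1 / e) powr s) (at_right 0)" using s t0 by real_asymp
  qed
  \<comment> \<open>Logarithms of the two counts: the left side is of order
    \<open>e powr -t * ln (1 / e)\<close>, the right side of order \<open>e powr -s\<close>, so
    \<open>t < s\<close> decides. The \<open>+ 2\<close> allows for the ceiling in \<open>K\<close>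
    and for the \<open>K + 1\<close> values of a code.\<close>
  moreover have "eventually (\<lambda>e. ((1 / (k * e)) powr t) * ln ((1 / (k * e)) powr (t + p') + 2)
      < ((1 / e) powr s - 1) * ln (9/8)) (at_right 0)"
    using s t0 k assms(5) by real_asymp
  ultimately have "eventually (\<lambda>e::real. False) (at_right 0)"
  proof eventually_elim
    case (elim e)
    define d where "d = k * e"
    have e: "0 < e" "2 * d \<le> 1" "2 \<le> (1 / e) powr s" and d: "0 < d" using elim(3) k by (auto simp: d_def)
    from elim(1) obtain C where C: "finite C" "(UNIV :: 'b set) \<subseteq> (\<Union>x\<in>C. ball x d)" "real (card C) \<le> (1 / d) powr t"
      unfolding d_def[symmetric] by (elim exE conjE) (rule that)
    from elim(2) obtain S :: "'a set" where S: "finite S" "(1 / e) powr s \<le> real (card S)"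
      and sep: "\<forall>x\<in>S. \<forall>y\<in>S. x \<noteq> y \<longrightarrow> e \<le> dist x y"
      by (elim exE conjE) (rule that)
    have S2: "2 \<le> card S" using e(3) S(2) by linarith
    from ex_large_wasserstein_separated_family[OF assms(4) e(1) S(1) S2 sep]
    obtain F :: "'a set set" and g :: "'a set \<Rightarrow> 'a measure" where F: "finite F" "(9/8) ^ (card S - 1) \<le> real (card F)"
      "g ` F \<subseteq> borel_prob_measures"
      "\<forall>A\<in>F. \<forall>B\<in>F. A \<noteq> B \<longrightarrow> e / 16 \<le> wasserstein_dist p (g A) (g B)"
      by (elim exE conjE) (rule that)
    \<comment> \<open>With \<open>card C\<close> at most \<open>(1 / d) powr t\<close>, this choice
      makes the total rounding error \<open>card C / K\<close> at most \<open>d powr p'\<close>, the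
      same order as the cost inside the cells.\<close>
    define K where "K = nat \<lceil>(1 / d) powr (t + p')\<rceil>"
    have K: "(1 / d) powr (t + p') \<le> real K" "real K \<le> (1 / d) powr (t + p') + 1"
      unfolding K_def by (auto simp: of_nat_nat intro: real_nat_ceiling_ge) 
    have "0 < (1 / d) powr (t + p')" using d by simp
    then have "0 < real K" using K(1) by linarith
    then have K0: "0 < K" by simp
    have "real (card C) * (1 / real K) \<le> d powr p'"
    proof -
      have "real (card C) * (1 / d) powr p' \<le> (1 / d) powr t * (1 / d) powr p'"
        using C(3) by (rule mult_right_mono) simp
      also have "\<dots> \<le> real K" using K(1) by (simp add: powr_add)
      finally show ?thesis using d K0 by (simp add: powr_divide field_simps)
    qed
    then have "(2 * d) powr p' + real (card C) * (1 / real K) * D powr p' \<le> (2 * d) powr p' + d powr p' * D powr p'"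
      by (intro add_left_mono mult_right_mono) auto
    also have "\<dots> = d powr p' * (2 powr p' + D powr p')"
      using d by (simp add: powr_mult algebra_simps)
    finally have "((2 * d) powr p' + real (card C) * (1 / real K) * D powr p') powr (1 / p')
        \<le> (d powr p' * (2 powr p' + D powr p')) powr (1 / p')"
      using assms(5) by (intro powr_mono2) auto
    also have "\<dots> = d * L"
      using d assms(5) unfolding L_def by (subst powr_mult) (auto simp: powr_powr)
    also have "\<dots> < c * (e / 16)" using L c e(1) by (simp add: d_def k_def)
    finally have small: "((2 * d) powr p' + real (card C) * (1 / real K) * D powr p') powr (1 / p') < c * (e / 16)" .
    \<comment> \<open>The images of the family under \<open>f\<close> keep the separation
      \<open>c * (e / 16)\<close>, so the count of codes in the target bounds the size of the
      family.\<close>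
    have "card F \<le> (K + 1) ^ card C"
    proof (rule card_wasserstein_separated_le[OF assms(2) F(1) _ C(1,2) _ d _ D K0 _ small])
      show "(\<lambda>A. f (g A)) ` F \<subseteq> borel_prob_measures" using f F(3) by auto
      show "0 < p'" using assms(5) by simp
      show "2 * d \<le> D" using e(2) D1 by simp
      fix A B assume AB: "A \<in> F" "B \<in> F" "A \<noteq> B"
      have "c * (e / 16) \<le> c * wasserstein_dist p (g A) (g B)"
        using F(4)[rule_format, OF AB] c by (intro mult_left_mono) auto
      also have "\<dots> \<le> wasserstein_dist p' (f (g A)) (f (g B))" using AB F(3) by (intro low) auto
      finally show "c * (e / 16) \<le> wasserstein_dist p' (f (g A)) (f (g B))" .
    qed
    then have "real (card F) \<le> real ((K + 1) ^ card C)" by (rule of_nat_mono)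
    with F(2) have "(9/8) ^ (card S - 1) \<le> (real K + 1) ^ card C" by (simp add: add.commute)
    then have "ln ((9/8) ^ (card S - 1)) \<le> ln ((real K + 1) ^ card C)" by (subst ln_le_cancel_iff) auto
    then have "(real (card S) - 1) * ln (9/8) \<le> real (card C) * ln (real K + 1)"
      using S2 by (simp add: ln_realpow of_nat_diff)
    also have "\<dots> \<le> (1 / d) powr t * ln ((1 / d) powr (t + p') + 2)"
      using C(3) K by (intro mult_mono) auto
    also have "\<dots> < ((1 / e) powr s - 1) * ln (9/8)" using elim(4) by (simp add: d_def)
    also have "\<dots> \<le> (real (card S) - 1) * ln (9/8)" using S(2) by (intro mult_right_mono) auto
    finally show False by simp
  qed
  then show False by simp
qed

end
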